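(* Let $G$ be an abelian group and let $X,Y,Z$ be $G$-valued random variables. Then: (i) $d^*_{\mathrm{ent}}(X,Z) \leq d_{\mathrm{ent}}(X,Y) + d_{\mathrm{ent}}(Y,Z)$. (ii) $d_{\mathrm{ent}}(X,Y) \leq d^*_{\mathrm{ent}}(X,Y) \leq 3\, d_{\mathrm{ent}}(X,Y)$.
   Context: A $G$-valued random variable is a random variable taking values in a finite subset of the (additively written) abelian group $G$. Its Shannon entropy is $\mathbf{H}(X) = \sum_x p_X(x)\log\frac{1}{p_X(x)}$, where $p_X(x)=\mathbf{P}(X=x)$, $\log$ is the natural logarithm, and terms with $p_X(x)=0$ are $0$. For $G$-valued random variables $X,Y$ (not necessarily independent or defined on the same sample space), the entropic Ruzsa distance is $$d_{\mathrm{ent}}(X,Y) = \mathbf{H}(X'-Y') - \tfrac12 \mathbf{H}(X') - \tfrac12\mathbf{H}(Y'),$$ where $X',Y'$ are independent copies of $X,Y$ respectively. The maximal entropic Ruzsa distance is $$d^*_{\mathrm{ent}}(X,Y) = \sup_{X',Y'}\left(\mathbf{H}(X'-Y') - \tfrac12 \mathbf{H}(X') - \tfrac12\mathbf{H}(Y')\right),$$ where $(X',Y')$ ranges over all pairs of random variables (on a common sample space, not required to be independent) with marginal distributions $p_X$, $p_Y$ respectively, i.e. all couplings of $X$ and $Y$. *)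

theory Defs
  imports "HOL-Probability.Probability"
begin

(* A random variable taking finitely many values: library notion simple_function asks that
   X ` space M is finite and that every level set is an event. *)
definition finite_rv :: "'s measure \<Rightarrow> ('s \<Rightarrow> 'a) \<Rightarrow> bool" where
  "finite_rv M X \<longleftrightarrow> prob_space M \<and> simple_function M X"

definition rv_prob :: "'s measure \<Rightarrow> ('s \<Rightarrow> 'a) \<Rightarrow> 'a \<Rightarrow> real" where
  "rv_prob M X x = measure M {w \<in> space M. X w = x}"

(* Terms of probability 0 vanish, since 0 * ln (1 / 0) = 0. *)
definition shannon_entropy :: "'s measure \<Rightarrow> ('s \<Rightarrow> 'a) \<Rightarrow> real" where
  "shannon_entropy M X = (\<Sum>x\<in>X ` space M. rv_prob M X x * ln (1 / rv_prob M X x))"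

definition same_law :: "'s measure \<Rightarrow> ('s \<Rightarrow> 'a) \<Rightarrow> 't measure \<Rightarrow> ('t \<Rightarrow> 'a) \<Rightarrow> bool" where
  "same_law M X N Y \<longleftrightarrow> (\<forall>x. rv_prob M X x = rv_prob N Y x)"

definition ent_diff :: "'s measure \<Rightarrow> ('s \<Rightarrow> 'a::ab_group_add) \<Rightarrow> ('s \<Rightarrow> 'a) \<Rightarrow> real" where
  "ent_diff P X Y = shannon_entropy P (\<lambda>w. X w - Y w)
     - 1 / 2 * shannon_entropy P X - 1 / 2 * shannon_entropy P Y"

(* The independent copies are the two coordinates on the product space; by
   d_ent_eq_indep_copies below, any other independent copies give the same value. *)
definition d_ent ::
    "'s measure \<Rightarrow> ('s \<Rightarrow> 'a::ab_group_add) \<Rightarrow> 't measure \<Rightarrow> ('t \<Rightarrow> 'a) \<Rightarrow> real" where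
  "d_ent M X N Y = ent_diff (M \<Otimes>\<^sub>M N) (X \<circ> fst) (Y \<circ> snd)"

definition coupling ::
    "'s measure \<Rightarrow> ('s \<Rightarrow> 'a) \<Rightarrow> 't measure \<Rightarrow> ('t \<Rightarrow> 'a) \<Rightarrow>
     'u measure \<Rightarrow> ('u \<Rightarrow> 'a) \<Rightarrow> ('u \<Rightarrow> 'a) \<Rightarrow> bool" where
  "coupling M X N Y P X' Y' \<longleftrightarrow>
     finite_rv P X' \<and> finite_rv P Y' \<and> same_law P X' M X \<and> same_law P Y' N Y"

(* HOL cannot quantify over all sample space types inside a definition, so the common sample
   space is an arbitrary measure on 'a \<times> 'a. By coupling_value_in_values below, couplings on any
   other sample space contribute no further values; by bdd_above_coupling_values and
   coupling_values_nonempty, Sup is a genuine supremum. *)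
definition coupling_values ::
    "'s measure \<Rightarrow> ('s \<Rightarrow> 'a::ab_group_add) \<Rightarrow> 't measure \<Rightarrow> ('t \<Rightarrow> 'a) \<Rightarrow> real set" where
  "coupling_values M X N Y =
     {ent_diff P X' Y' | (P :: ('a \<times> 'a) measure) X' Y'. coupling M X N Y P X' Y'}"

definition d_ent_max ::
    "'s measure \<Rightarrow> ('s \<Rightarrow> 'a::ab_group_add) \<Rightarrow> 't measure \<Rightarrow> ('t \<Rightarrow> 'a) \<Rightarrow> real" where
  "d_ent_max M X N Y = Sup (coupling_values M X N Y)"


lemma rv_prob_outside: "x \<notin> X ` space M \<Longrightarrow> rv_prob M X x = 0"
proof -
  assume "x \<notin> X ` space M"
  then have "{w \<in> space M. X w = x} = {}" by auto
  then show ?thesis by (simp only: rv_prob_def measure_empty)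
qed

lemma finite_rv_compose: "finite_rv M X \<Longrightarrow> finite_rv M (\<lambda>w. f (X w))"
  unfolding finite_rv_def using simple_function_compose[of M X f] by (simp add: comp_def)

lemma finite_rv_Pair: "finite_rv M X \<Longrightarrow> finite_rv M Y \<Longrightarrow> finite_rv M (\<lambda>w. (X w, Y w))"
  unfolding finite_rv_def by (auto intro: simple_function_Pair)

lemma shannon_entropy_superset:
  assumes "finite S" "X ` space M \<subseteq> S"
  shows "shannon_entropy M X = (\<Sum>x\<in>S. rv_prob M X x * ln (1 / rv_prob M X x))"
  unfolding shannon_entropy_def
  by (rule sum.mono_neutral_left) (use assms in \<open>auto simp: rv_prob_outside\<close>)

lemma shannon_entropy_cong:
  assumes "finite_rv M X" "finite_rv N Y" "same_law M X N Y"
  shows "shannon_entropy M X = shannon_entropy N Y"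
proof -
  have fin: "finite (X ` space M \<union> Y ` space N)"
    using assms by (simp add: finite_rv_def simple_function_def)
  show ?thesis
    using assms(3) shannon_entropy_superset[OF fin, of X M] shannon_entropy_superset[OF fin, of Y N]
    by (simp add: same_law_def)
qed

lemma rv_prob_compose:
  assumes "finite_rv M W" "finite S" "W ` space M \<subseteq> S"
  shows "rv_prob M (\<lambda>w. f (W w)) z = (\<Sum>v\<in>{v\<in>S. f v = z}. rv_prob M W v)"
proof -
  interpret prob_space M using assms by (simp add: finite_rv_def)
  have eq: "{w \<in> space M. f (W w) = z} = (\<Union>v\<in>{v\<in>S. f v = z}. {w \<in> space M. W w = v})"
    using assms by auto
  have meas: "{w \<in> space M. W w = v} \<in> sets M" for v
    using assms(1) simple_functionD(2)[of M W "{v}"]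
    by (auto simp: finite_rv_def vimage_def Int_def conj_commute)
  show ?thesis unfolding rv_prob_def eq
    by (rule finite_measure_finite_Union) (use assms meas in \<open>auto simp: disjoint_family_on_def\<close>)
qed

lemma same_law_compose:
  assumes "finite_rv M W" "finite_rv N V" "same_law M W N V"
  shows "same_law M (\<lambda>w. f (W w)) N (\<lambda>w. f (V w))"
proof -
  have fin: "finite (W ` space M \<union> V ` space N)"
    using assms by (simp add: finite_rv_def simple_function_def)
  show ?thesis
    using assms(3) rv_prob_compose[OF assms(1) fin, of f] rv_prob_compose[OF assms(2) fin, of f]
    by (simp add: same_law_def)
qed

lemma ent_diff_cong:
  assumes "finite_rv P X" "finite_rv P Y" "finite_rv Q X'" "finite_rv Q Y'"
    and "same_law P (\<lambda>w. (X w, Y w)) Q (\<lambda>w. (X' w, Y' w))"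
  shows "ent_diff P X Y = ent_diff Q X' Y'"
proof -
  let ?W = "\<lambda>w. (X w, Y w)" and ?V = "\<lambda>w. (X' w, Y' w)"
  note W = finite_rv_Pair[OF assms(1,2)] and V = finite_rv_Pair[OF assms(3,4)]
  have "shannon_entropy P (\<lambda>w. f (?W w)) = shannon_entropy Q (\<lambda>w. f (?V w))"
    for f :: "'b \<times> 'b \<Rightarrow> 'b"
    by (rule shannon_entropy_cong[OF finite_rv_compose[OF W] finite_rv_compose[OF V]
          same_law_compose[OF W V assms(5)]])
  from this[of "\<lambda>p. fst p - snd p"] this[of fst] this[of snd]
  show ?thesis by (simp add: ent_diff_def)
qed

lemma same_law_refl: "same_law M X M X"
  by (simp add: same_law_def)

lemma finite_rv_measurable: "finite_rv M X \<Longrightarrow> X \<in> measurable M (count_space UNIV)"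
  by (simp add: finite_rv_def measurable_simple_function)

lemma finite_rv_from:
  assumes "prob_space M" "X \<in> measurable M (count_space UNIV)" "finite (X ` space M)"
  shows "finite_rv M X"
  using assms measurable_sets[OF assms(2)]
  by (auto simp: finite_rv_def simple_function_def)

lemma finite_rv_coords:
  assumes "finite_rv M X" "finite_rv N Y"
  shows "finite_rv (M \<Otimes>\<^sub>M N) (X \<circ> fst)" "finite_rv (M \<Otimes>\<^sub>M N) (Y \<circ> snd)"
proof -
  interpret M: prob_space M using assms by (simp add: finite_rv_def)
  interpret N: prob_space N using assms by (simp add: finite_rv_def)
  interpret pair_prob_space M N ..
  have p: "prob_space (M \<Otimes>\<^sub>M N)" by (rule P.prob_space_axioms)
  note [measurable] = assms[THEN finite_rv_measurable]
  have "finite (X ` space M)" "finite (Y ` space N)"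
    using assms by (auto simp: finite_rv_def simple_function_def)
  then have "finite ((X \<circ> fst) ` space (M \<Otimes>\<^sub>M N))" "finite ((Y \<circ> snd) ` space (M \<Otimes>\<^sub>M N))"
    by (auto elim!: finite_subset[rotated] simp: space_pair_measure)
  then show "finite_rv (M \<Otimes>\<^sub>M N) (X \<circ> fst)" "finite_rv (M \<Otimes>\<^sub>M N) (Y \<circ> snd)"
    by (auto intro!: finite_rv_from p simp: comp_def)
qed

lemma rv_prob_product:
  assumes "finite_rv M X" "finite_rv N Y"
  shows "rv_prob (M \<Otimes>\<^sub>M N) (\<lambda>w. ((X \<circ> fst) w, (Y \<circ> snd) w)) (x, y)
    = rv_prob M X x * rv_prob N Y y"
proof -
  interpret M: prob_space M using assms by (simp add: finite_rv_def)
  interpret N: prob_space N using assms by (simp add: finite_rv_def)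
  note [measurable] = assms[THEN finite_rv_measurable]
  have "{w \<in> space (M \<Otimes>\<^sub>M N). ((X \<circ> fst) w, (Y \<circ> snd) w) = (x, y)}
    = {w \<in> space M. X w = x} \<times> {w \<in> space N. Y w = y}"
    by (auto simp: space_pair_measure)
  moreover have "{w \<in> space M. X w = x} \<in> sets M" "{w \<in> space N. Y w = y} \<in> sets N"
    by measurable
  ultimately show ?thesis
    unfolding rv_prob_def by (simp add: measure_def N.emeasure_pair_measure_Times enn2real_mult)
qed

lemma d_ent_eq_indep_copies:
  assumes XY: "finite_rv M X" "finite_rv N Y" and c: "coupling M X N Y P X' Y'"
    and ind: "prob_space.indep_var P (count_space UNIV) X' (count_space UNIV) Y'"
  shows "ent_diff P X' Y' = d_ent M X N Y"
  unfolding d_ent_def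
proof (rule ent_diff_cong)
  show f: "finite_rv P X'" "finite_rv P Y'" using c by (auto simp: coupling_def)
  show "finite_rv (M \<Otimes>\<^sub>M N) (X \<circ> fst)" "finite_rv (M \<Otimes>\<^sub>M N) (Y \<circ> snd)"
    by (rule finite_rv_coords[OF XY])+
  interpret prob_space P using f by (simp add: finite_rv_def)
  have "rv_prob P (\<lambda>w. (X' w, Y' w)) (x, y) = rv_prob P X' x * rv_prob P Y' y" for x y
    using indep_varD[OF ind, of "{x}" "{y}"]
    by (simp add: rv_prob_def vimage_def Int_def conj_ac)
  then show "same_law P (\<lambda>w. (X' w, Y' w)) (M \<Otimes>\<^sub>M N) (\<lambda>w. ((X \<circ> fst) w, (Y \<circ> snd) w))"
    using c by (auto simp only: same_law_def split_paired_All rv_prob_product[OF XY] coupling_def)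
qed

lemma coupling_value_in_values:
  fixes X' :: "'u \<Rightarrow> 'a::ab_group_add"
  assumes c: "coupling M X N Y P X' Y'"
  shows "ent_diff P X' Y' \<in> coupling_values M X N Y"
proof -
  let ?W = "\<lambda>w. (X' w, Y' w)"
  have f: "finite_rv P X'" "finite_rv P Y'" using c by (auto simp: coupling_def)
  interpret prob_space P using f by (simp add: finite_rv_def)
  define S where "S = ?W ` space P"
  have finS: "finite S" using finite_rv_Pair[OF f] by (simp add: S_def finite_rv_def simple_function_def)
  define Q where "Q = distr P (count_space S) ?W"
  have m: "?W \<in> measurable P (count_space S)"
  proof -
    have "?W -` A \<inter> space P \<in> sets P" for A
      using measurable_sets[OF finite_rv_measurable[OF finite_rv_Pair[OF f]], of A] by simp
    then show ?thesis by (auto simp: measurable_def S_def)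
  qed
  have Q: "prob_space Q" unfolding Q_def by (rule prob_space_distr[OF m])
  have fQ: "finite_rv Q g" for g :: "'a \<times> 'a \<Rightarrow> 'a"
    using Q finS by (intro finite_rv_from) (auto simp: Q_def)
  have pre: "?W -` {w \<in> S. R w} \<inter> space P = {w \<in> space P. R (?W w)}" for R
    by (auto simp: S_def)
  have law: "measure Q {w \<in> space Q. R w} = measure P {w \<in> space P. R (?W w)}" for R
    unfolding Q_def using measure_distr[OF m, of "{w \<in> S. R w}"] pre[of R] by simp
  have "same_law P ?W Q (\<lambda>p. (fst p, snd p))"
    unfolding same_law_def rv_prob_def law by simp
  then have "ent_diff P X' Y' = ent_diff Q fst snd"
    by (rule ent_diff_cong[OF f fQ fQ])
  moreover have "coupling M X N Y Q fst snd"
    using c fQ by (simp add: coupling_def same_law_def rv_prob_def law)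
  ultimately show ?thesis unfolding coupling_values_def by blast
qed

lemma coupling_product:
  assumes "finite_rv M X" "finite_rv N Y"
  shows "coupling M X N Y (M \<Otimes>\<^sub>M N) (X \<circ> fst) (Y \<circ> snd)"
proof -
  interpret M: prob_space M using assms by (simp add: finite_rv_def)
  interpret N: prob_space N using assms by (simp add: finite_rv_def)
  note [measurable] = assms[THEN finite_rv_measurable]
  have mx: "{w \<in> space M. X w = x} \<in> sets M" and my: "{w \<in> space N. Y w = y} \<in> sets N" for x y
    by measurable
  have "{w \<in> space (M \<Otimes>\<^sub>M N). (X \<circ> fst) w = x} = {w \<in> space M. X w = x} \<times> space N" for x
    by (auto simp: space_pair_measure)
  moreover have "{w \<in> space (M \<Otimes>\<^sub>M N). (Y \<circ> snd) w = y} = space M \<times> {w \<in> space N. Y w = y}" for y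
    by (auto simp: space_pair_measure)
  ultimately show ?thesis
    using assms finite_rv_coords[OF assms] mx my
    by (simp add: coupling_def same_law_def rv_prob_def measure_def N.emeasure_pair_measure_Times
        M.emeasure_space_1 N.emeasure_space_1)
qed

lemma coupling_values_nonempty:
  "finite_rv M X \<Longrightarrow> finite_rv N Y \<Longrightarrow> coupling_values M X N Y \<noteq> {}"
  using coupling_value_in_values[OF coupling_product] by blast

lemma plogp_le_one: "0 \<le> p \<Longrightarrow> p * ln (1 / p) \<le> (1::real)"
proof (cases "p = 0")
  case False
  moreover assume "0 \<le> p"
  ultimately have p: "p > 0" by simp
  then have "p * ln (1 / p) \<le> p * (1 / p)"
    by (intro mult_left_mono ln_bound) auto
  then show ?thesis using p by simp
qed auto

lemma shannon_entropy_le_support: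
  assumes "finite_rv M X" "finite S" "\<And>x. x \<notin> S \<Longrightarrow> rv_prob M X x = 0"
  shows "shannon_entropy M X \<le> card S"
proof -
  have fin: "finite (X ` space M \<union> S)"
    using assms by (simp add: finite_rv_def simple_function_def)
  have "shannon_entropy M X = (\<Sum>x\<in>S. rv_prob M X x * ln (1 / rv_prob M X x))"
    unfolding shannon_entropy_superset[OF fin Un_upper1]
    by (rule sum.mono_neutral_right) (use fin assms(3) in auto)
  also have "\<dots> \<le> (\<Sum>x\<in>S. 1)"
    by (intro sum_mono plogp_le_one) (simp add: rv_prob_def)
  finally show ?thesis by simp
qed

lemma shannon_entropy_nonneg:
  assumes "prob_space M"
  shows "shannon_entropy M X \<ge> 0"
  unfolding shannon_entropy_def
proof (intro sum_nonneg)
  interpret prob_space M by fact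
  fix x
  have "rv_prob M X x \<ge> 0" "rv_prob M X x \<le> 1" by (simp_all add: rv_prob_def)
  then show "0 \<le> rv_prob M X x * ln (1 / rv_prob M X x)"
    by (cases "rv_prob M X x = 0") (auto intro!: mult_nonneg_nonneg simp: field_simps)
qed

lemma bdd_above_coupling_values:
  fixes X :: "'s \<Rightarrow> 'a::ab_group_add"
  assumes "finite_rv M X" "finite_rv N Y"
  shows "bdd_above (coupling_values M X N Y)"
proof (rule bdd_aboveI)
  let ?A = "X ` space M" and ?B = "Y ` space N"
  let ?S = "(\<lambda>(a, b). a - b) ` (?A \<times> ?B)"
  have finS: "finite ?S"
    using assms by (simp add: finite_rv_def simple_function_def)
  fix v assume "v \<in> coupling_values M X N Y"
  then obtain P :: "('a \<times> 'a) measure" and X' Y'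
    where v: "v = ent_diff P X' Y'" and c: "coupling M X N Y P X' Y'"
    by (auto simp: coupling_values_def)
  have f: "finite_rv P X'" "finite_rv P Y'" using c by (auto simp: coupling_def)
  interpret prob_space P using f by (simp add: finite_rv_def)
  note [measurable] = f[THEN finite_rv_measurable]
  have fd: "finite_rv P (\<lambda>w. X' w - Y' w)"
    using finite_rv_compose[OF finite_rv_Pair[OF f], of "\<lambda>p. fst p - snd p"] by simp
  have "rv_prob P (\<lambda>w. X' w - Y' w) z = 0" if z: "z \<notin> ?S" for z
  proof -
    have fin': "finite (X' ` space P \<times> Y' ` space P)"
      using f by (simp add: finite_rv_def simple_function_def)
    have zero: "rv_prob P (\<lambda>w. (X' w, Y' w)) p = 0" if p: "fst p - snd p = z" for p
    proof -
      obtain a b where ab: "p = (a, b)" by force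
      have "a \<notin> ?A \<or> b \<notin> ?B" using z p ab by force
      then have "rv_prob P X' a = 0 \<or> rv_prob P Y' b = 0"
        using c rv_prob_outside[of a X M] rv_prob_outside[of b Y N]
        by (auto simp: coupling_def same_law_def)
      moreover have "rv_prob P (\<lambda>w. (X' w, Y' w)) p \<le> rv_prob P X' a"
        "rv_prob P (\<lambda>w. (X' w, Y' w)) p \<le> rv_prob P Y' b"
        unfolding rv_prob_def ab by (auto intro!: finite_measure_mono)
      moreover have "rv_prob P (\<lambda>w. (X' w, Y' w)) p \<ge> 0" by (simp add: rv_prob_def)
      ultimately show ?thesis by linarith
    qed
    have "rv_prob P (\<lambda>w. (\<lambda>p. fst p - snd p) (X' w, Y' w)) z = 0"
      by (subst rv_prob_compose[OF finite_rv_Pair[OF f] fin']) (auto intro!: sum.neutral zero)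
    then show ?thesis by simp
  qed
  then have "shannon_entropy P (\<lambda>w. X' w - Y' w) \<le> card ?S"
    by (intro shannon_entropy_le_support fd finS)
  then show "v \<le> card ?S"
    using shannon_entropy_nonneg[OF prob_space_axioms, of X']
      shannon_entropy_nonneg[OF prob_space_axioms, of Y']
    unfolding v ent_diff_def by linarith
qed

end

theory Submission
  imports Defs
begin

text \<open>For a coupling of X and Z, take Y independent of the pair. Both (X - Y, Z - Y) and (X, Z)
determine X - Z, and together they determine (X, Y, Z), so submodularity and independence give
H(Y) + H(X - Z) \<le> H(X - Y, Z - Y) \<le> H(X - Y) + H(Z - Y), which is (i). Applying (i) with the
middle variable X bounds the maximal distance of X and Y by d(X, X) + d(X, Y), and
d(X, X) \<le> 2 d(X, Y) is (i) again.\<close>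

section \<open>Entropy under functions and relabellings\<close>

text \<open>Grouping the values of \<open>W\<close> by their image under \<open>f\<close> gives a
  sum indexed by the range of \<open>W\<close> itself. Entropies of different functions of one
  \<open>W\<close> thus share an index set and can be compared term by term.\<close>

lemma shannon_entropy_compose:
  assumes W: "finite_rv M W"
  shows "shannon_entropy M (\<lambda>w. f (W w))
    = (\<Sum>v\<in>W ` space M. rv_prob M W v * ln (1 / rv_prob M (\<lambda>w. f (W w)) (f v)))"
proof -
  let ?S = "W ` space M"
  have fin: "finite ?S" using W by (simp add: finite_rv_def simple_function_def)
  have "shannon_entropy M (\<lambda>w. f (W w)) =
      (\<Sum>z\<in>f ` ?S. rv_prob M (\<lambda>w. f (W w)) z * ln (1 / rv_prob M (\<lambda>w. f (W w)) z))"
    by (rule shannon_entropy_superset) (use fin in auto)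
  also have "\<dots> = (\<Sum>z\<in>f ` ?S. \<Sum>v\<in>{v \<in> ?S. f v = z}.
      rv_prob M W v * ln (1 / rv_prob M (\<lambda>w. f (W w)) (f v)))"
    by (intro sum.cong refl, subst rv_prob_compose[OF W fin subset_refl, of f])
      (simp add: sum_distrib_right)
  also have "\<dots> = (\<Sum>v\<in>?S. rv_prob M W v * ln (1 / rv_prob M (\<lambda>w. f (W w)) (f v)))"
    by (rule sum.image_gen[OF fin, symmetric])
  finally show ?thesis .
qed

lemma rv_prob_compose_ge:
  assumes "finite_rv M W"
  shows "rv_prob M W v \<le> rv_prob M (\<lambda>w. f (W w)) (f v)"
proof -
  interpret prob_space M using assms by (simp add: finite_rv_def)
  note [measurable] = finite_rv_measurable[OF finite_rv_compose[OF assms, of f]]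
  show ?thesis
    unfolding rv_prob_def by (rule finite_measure_mono) auto
qed

text \<open>On the two ranges \<open>f\<close> and \<open>g\<close> are mutually inverse, so
  \<open>Y\<close> merely relabels the values of \<open>X\<close>. This serves to drop redundant
  coordinates from tuples.\<close>

lemma shannon_entropy_determined:
  assumes "\<And>w. w \<in> space M \<Longrightarrow> Y w = f (X w)" "\<And>w. w \<in> space M \<Longrightarrow> X w = g (Y w)"
  shows "shannon_entropy M Y = shannon_entropy M X"
proof -
  have inj: "inj_on f (X ` space M)"
  proof (rule inj_on_inverseI)
    fix x assume "x \<in> X ` space M"
    then show "g (f x) = x" using assms by (metis imageE)
  qed
  have img: "Y ` space M = f ` X ` space M" using assms(1) by (auto simp: image_image)
  have "rv_prob M Y (f x) = rv_prob M X x" if "x \<in> X ` space M" for x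
  proof -
    have "f (X w) = f x \<longleftrightarrow> X w = x" if "w \<in> space M" for w
      using inj_on_eq_iff[OF inj _ \<open>x \<in> X ` space M\<close>] that by simp
    then have "{w \<in> space M. Y w = f x} = {w \<in> space M. X w = x}"
      by (auto simp: assms(1))
    then show ?thesis by (simp only: rv_prob_def)
  qed
  then show ?thesis
    unfolding shannon_entropy_def img sum.reindex[OF inj] by simp
qed

section \<open>Submodularity and subadditivity\<close>

text \<open>The right side minus the left side is the conditional mutual information of
  \<open>U\<close> and \<open>V\<close> given \<open>C\<close>, which is nonnegative.\<close>

lemma shannon_entropy_submodular:
  assumes U: "finite_rv M U" and V: "finite_rv M V" and C: "finite_rv M C"
  shows "shannon_entropy M (\<lambda>w. (U w, V w, C w)) + shannon_entropy M C
    \<le> shannon_entropy M (\<lambda>w. (U w, C w)) + shannon_entropy M (\<lambda>w. (V w, C w))"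
proof -
  \<comment> \<open>Base e makes \<open>log\<close> the natural logarithm, matching
    \<open>shannon_entropy\<close>.\<close>
  interpret information_space M "exp 1"
    using U by (simp add: finite_rv_def information_space_def information_space_axioms_def)
  let ?W = "\<lambda>w. (U w, V w, C w)"
  let ?S = "?W ` space M"
  let ?p = "rv_prob M ?W" and ?pc = "rv_prob M C"
  let ?pu = "rv_prob M (\<lambda>w. (U w, C w))" and ?pv = "rv_prob M (\<lambda>w. (V w, C w))"
  have sd: "simple_distributed M X (rv_prob M X)" if "finite_rv M X" for X :: "'a \<Rightarrow> 'x"
    using that by (intro simple_distributedI)
      (auto simp: finite_rv_def rv_prob_def vimage_def Int_def conj_commute)
  note UC = finite_rv_Pair[OF U C] and VC = finite_rv_Pair[OF V C]
  note W = finite_rv_Pair[OF U VC]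
  have comp: "shannon_entropy M (\<lambda>w. f (?W w)) =
      (\<Sum>v\<in>?S. ?p v * ln (1 / rv_prob M (\<lambda>w. f (?W w)) (f v)))" for f :: "_ \<Rightarrow> 'y"
    by (rule shannon_entropy_compose[OF W])
  let ?I = "conditional_mutual_information (exp 1)
    (count_space (U ` space M)) (count_space (V ` space M)) (count_space (C ` space M)) U V C"
  have "0 \<le> ?I"
    by (rule conditional_mutual_information_nonneg) (use U V C in \<open>auto simp: finite_rv_def\<close>)
  also have "?I = (\<Sum>(x, y, z)\<in>?S.
      ?p (x, y, z) * log (exp 1) (?p (x, y, z) / (?pu (x, z) * (?pv (y, z) / ?pc z))))"
    by (rule conditional_mutual_information_eq[OF sd[OF C] sd[OF VC] sd[OF UC] sd[OF W]])
  also have "\<dots> = (\<Sum>(x, y, z)\<in>?S. ?p (x, y, z) * ln (1 / ?pu (x, z))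
      + ?p (x, y, z) * ln (1 / ?pv (y, z)) - ?p (x, y, z) * ln (1 / ?pc z)
      - ?p (x, y, z) * ln (1 / ?p (x, y, z)))"
  proof (rule sum.cong[OF refl], clarify)
    fix w assume "w \<in> space M"
    define x y z where "x = U w" and "y = V w" and "z = C w"
    \<comment> \<open>Where the joint probability is positive, so are the marginals, and the
      logarithm splits; where it is zero, both sides vanish.\<close>
    have le: "?p (x, y, z) \<le> ?pu (x, z)" "?p (x, y, z) \<le> ?pv (y, z)" "?p (x, y, z) \<le> ?pc z"
      using rv_prob_compose_ge[OF W, of "(x, y, z)" "\<lambda>(u, v, c). (u, c)"]
        rv_prob_compose_ge[OF W, of "(x, y, z)" "\<lambda>(u, v, c). (v, c)"]
        rv_prob_compose_ge[OF W, of "(x, y, z)" "\<lambda>(u, v, c). c"] by auto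
    have "?p (x, y, z) \<ge> 0" by (simp add: rv_prob_def)
    then consider "?p (x, y, z) = 0" | "?p (x, y, z) > 0" by linarith
    then show "?p (U w, V w, C w) * log (exp 1) (?p (U w, V w, C w) /
        (?pu (U w, C w) * (?pv (V w, C w) / ?pc (C w)))) =
      ?p (U w, V w, C w) * ln (1 / ?pu (U w, C w)) + ?p (U w, V w, C w) * ln (1 / ?pv (V w, C w))
      - ?p (U w, V w, C w) * ln (1 / ?pc (C w)) - ?p (U w, V w, C w) * ln (1 / ?p (U w, V w, C w))"
      unfolding x_def[symmetric] y_def[symmetric] z_def[symmetric]
    proof cases
      case 2
      with le have "?pu (x, z) > 0" "?pv (y, z) > 0" "?pc z > 0" by linarith+
      with 2 show "?p (x, y, z) * log (exp 1) (?p (x, y, z) / (?pu (x, z) * (?pv (y, z) / ?pc z))) =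
        ?p (x, y, z) * ln (1 / ?pu (x, z)) + ?p (x, y, z) * ln (1 / ?pv (y, z))
        - ?p (x, y, z) * ln (1 / ?pc z) - ?p (x, y, z) * ln (1 / ?p (x, y, z))"
        by (simp add: log_def ln_div ln_mult algebra_simps)
    qed simp
  qed
  also have "\<dots> = shannon_entropy M (\<lambda>w. (U w, C w)) + shannon_entropy M (\<lambda>w. (V w, C w))
      - shannon_entropy M C - shannon_entropy M ?W"
    using comp[of "\<lambda>(u, v, c). (u, c)"] comp[of "\<lambda>(u, v, c). (v, c)"]
      comp[of "\<lambda>(u, v, c). c"] comp[of "\<lambda>v. v"]
    by (simp add: sum_subtractf sum.distrib case_prod_unfold)
  finally show ?thesis by simp
qed

lemma finite_rv_const: "prob_space M \<Longrightarrow> finite_rv M (\<lambda>_. c)"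
  by (simp add: finite_rv_def)

lemma shannon_entropy_const:
  assumes "prob_space M"
  shows "shannon_entropy M (\<lambda>_. c) = 0"
proof -
  interpret prob_space M by fact
  show ?thesis by (auto simp: shannon_entropy_def rv_prob_def prob_space image_constant_conv)
qed

text \<open>Submodularity with the constant \<open>()\<close> as conditioning variable, whose
  entropy is 0.\<close>

lemma shannon_entropy_subadditive:
  assumes U: "finite_rv M U" and V: "finite_rv M V"
  shows "shannon_entropy M (\<lambda>w. (U w, V w)) \<le> shannon_entropy M U + shannon_entropy M V"
proof -
  have p: "prob_space M" using U by (simp add: finite_rv_def)
  have "shannon_entropy M (\<lambda>w. (U w, V w, ())) = shannon_entropy M (\<lambda>w. (U w, V w))"
    by (rule shannon_entropy_determined[where f = "\<lambda>(u, v). (u, v, ())" and g = "\<lambda>(u, v, _). (u, v)"]) auto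
  moreover have "shannon_entropy M (\<lambda>w. (U w, ())) = shannon_entropy M U"
    by (rule shannon_entropy_determined[where f = "\<lambda>u. (u, ())" and g = fst]) auto
  moreover have "shannon_entropy M (\<lambda>w. (V w, ())) = shannon_entropy M V"
    by (rule shannon_entropy_determined[where f = "\<lambda>u. (u, ())" and g = fst]) auto
  ultimately show ?thesis
    using shannon_entropy_submodular[OF U V finite_rv_const[OF p, of "()"]]
    by (simp add: shannon_entropy_const[OF p])
qed

section \<open>Entropy on product spaces\<close>

lemma sum_rv_prob:
  assumes "finite_rv M X"
  shows "(\<Sum>x\<in>X ` space M. rv_prob M X x) = 1"
proof -
  interpret prob_space M using assms by (simp add: finite_rv_def)
  have "finite (X ` space M)" using assms by (simp add: finite_rv_def simple_function_def)
  \<comment> \<open>Under the constant map to \<open>()\<close> every value of \<open>X\<close> lies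
    in one fibre, so the composition formula returns the total mass.\<close>
  from rv_prob_compose[OF assms this subset_refl, of "\<lambda>_. ()" "()"] show ?thesis
    by (simp add: rv_prob_def prob_space)
qed

text \<open>The joint law is a product, so the logarithm splits into two terms; in each, the other
  factor sums to 1.\<close>

lemma shannon_entropy_product:
  assumes X: "finite_rv M X" and Y: "finite_rv N Y"
  shows "shannon_entropy (M \<Otimes>\<^sub>M N) (\<lambda>w. (X (fst w), Y (snd w)))
    = shannon_entropy M X + shannon_entropy N Y"
proof -
  let ?A = "X ` space M" and ?B = "Y ` space N"
  let ?p = "rv_prob M X" and ?q = "rv_prob N Y"
  have fin: "finite ?A" "finite ?B" using X Y by (auto simp: finite_rv_def simple_function_def)
  have mul: "p * q * ln (1 / (p * q)) = q * (p * ln (1 / p)) + p * (q * ln (1 / q))"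
    if "p \<ge> 0" "q \<ge> 0" for p q :: real
  proof (cases "p = 0 \<or> q = 0")
    case False
    with that have "ln (1 / (p * q)) = ln (1 / p) + ln (1 / q)"
      by (simp add: ln_div ln_mult)
    then show ?thesis by (simp add: distrib_left mult_ac)
  qed auto
  have "shannon_entropy (M \<Otimes>\<^sub>M N) (\<lambda>w. (X (fst w), Y (snd w)))
      = (\<Sum>(x, y)\<in>?A \<times> ?B. ?p x * ?q y * ln (1 / (?p x * ?q y)))"
    by (subst shannon_entropy_superset[of "?A \<times> ?B"])
      (use fin rv_prob_product[OF X Y] in \<open>auto simp: space_pair_measure intro!: sum.cong\<close>)
  also have "\<dots> = (\<Sum>x\<in>?A. \<Sum>y\<in>?B. ?q y * (?p x * ln (1 / ?p x)) + ?p x * (?q y * ln (1 / ?q y)))"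
    unfolding sum.cartesian_product[symmetric]
    by (intro sum.cong refl mul) (auto simp: rv_prob_def)
  also have "\<dots> = shannon_entropy M X + shannon_entropy N Y"
    unfolding sum.distrib
    by (simp only: sum_distrib_right[symmetric] sum_distrib_left[symmetric]
        sum_rv_prob[OF X] sum_rv_prob[OF Y] shannon_entropy_def mult_1_left)
  finally show ?thesis .
qed

text \<open>Pairing with a constant variable on \<open>N\<close> makes
  \<open>coupling_product\<close> show that the first coordinate keeps its law.\<close>

lemma shannon_entropy_fst:
  assumes X: "finite_rv M X" and N: "prob_space N"
  shows "shannon_entropy (M \<Otimes>\<^sub>M N) (\<lambda>w. X (fst w)) = shannon_entropy M X"
  using coupling_product[OF X finite_rv_const[OF N]]
    shannon_entropy_cong[of "M \<Otimes>\<^sub>M N" "X \<circ> fst" M X] X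
  by (auto simp: coupling_def comp_def)

lemma shannon_entropy_snd:
  assumes Y: "finite_rv N Y" and M: "prob_space M"
  shows "shannon_entropy (M \<Otimes>\<^sub>M N) (\<lambda>w. Y (snd w)) = shannon_entropy N Y"
  using coupling_product[OF finite_rv_const[OF M] Y]
    shannon_entropy_cong[of "M \<Otimes>\<^sub>M N" "Y \<circ> snd" N Y] Y
  by (auto simp: coupling_def comp_def)

section \<open>Symmetry and invariance of the distance\<close>

lemma finite_rv_diff:
  fixes X :: "'s \<Rightarrow> 'a::ab_group_add"
  assumes "finite_rv M X" "finite_rv M Y"
  shows "finite_rv M (\<lambda>w. X w - Y w)"
  using finite_rv_compose[OF finite_rv_Pair[OF assms], of "\<lambda>p. fst p - snd p"] by simp

text \<open>Negation is a relabelling that exchanges the two differences.\<close>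

lemma ent_diff_commute: "ent_diff P X Y = ent_diff P Y X"
proof -
  have "shannon_entropy P (\<lambda>w. X w - Y w) = shannon_entropy P (\<lambda>w. Y w - X w)"
    by (rule shannon_entropy_determined[where f = uminus and g = uminus]) auto
  then show ?thesis by (simp add: ent_diff_def)
qed

text \<open>Under independence the marginals fix the joint law. This allows a marginal of a coupling
  to be replaced by the original variable.\<close>

lemma d_ent_cong:
  assumes "finite_rv M X" "finite_rv N Y" "finite_rv M' X'" "finite_rv N' Y'"
    and "same_law M X M' X'" "same_law N Y N' Y'"
  shows "d_ent M X N Y = d_ent M' X' N' Y'"
  unfolding d_ent_def
proof (rule ent_diff_cong)
  show "same_law (M \<Otimes>\<^sub>M N) (\<lambda>w. ((X \<circ> fst) w, (Y \<circ> snd) w))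
      (M' \<Otimes>\<^sub>M N') (\<lambda>w. ((X' \<circ> fst) w, (Y' \<circ> snd) w))"
    using assms(5,6) unfolding same_law_def split_paired_All
      rv_prob_product[OF assms(1,2)] rv_prob_product[OF assms(3,4)] by simp
qed (use assms finite_rv_coords in blast)+

lemma d_ent_commute:
  assumes X: "finite_rv M X" and Y: "finite_rv N Y"
  shows "d_ent M X N Y = d_ent N Y M X"
proof -
  note c1 = finite_rv_coords[OF X Y] and c2 = finite_rv_coords[OF Y X]
  \<comment> \<open>Swapping the factors of the product preserves the joint law of the pair; the
    order of subtraction is reversed only afterwards.\<close>
  have "ent_diff (M \<Otimes>\<^sub>M N) (X \<circ> fst) (Y \<circ> snd) = ent_diff (N \<Otimes>\<^sub>M M) (X \<circ> snd) (Y \<circ> fst)"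
  proof (rule ent_diff_cong[OF c1 c2(2,1)])
    show "same_law (M \<Otimes>\<^sub>M N) (\<lambda>w. ((X \<circ> fst) w, (Y \<circ> snd) w))
      (N \<Otimes>\<^sub>M M) (\<lambda>w. ((X \<circ> snd) w, (Y \<circ> fst) w))"
      unfolding same_law_def split_paired_All
    proof (intro allI)
      fix a b
      show "rv_prob (M \<Otimes>\<^sub>M N) (\<lambda>w. ((X \<circ> fst) w, (Y \<circ> snd) w)) (a, b) =
          rv_prob (N \<Otimes>\<^sub>M M) (\<lambda>w. ((X \<circ> snd) w, (Y \<circ> fst) w)) (a, b)"
        using rv_prob_product[OF X Y, of a b] rv_prob_product[OF Y X, of b a]
        by (simp add: rv_prob_def conj_commute mult.commute)
    qed
  qed
  then show ?thesis
    unfolding d_ent_def by (simp add: ent_diff_commute[of _ "X \<circ> snd"])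
qed

section \<open>Triangle inequality and comparison of the distances\<close>

text \<open>\<open>X\<close> and \<open>Z\<close> live on the same space \<open>P\<close> and may
  depend on each other in any way; \<open>Y\<close> comes from a second factor \<open>N\<close>,
  which makes it independent of the pair.\<close>

lemma ent_diff_triangle:
  fixes X Z :: "'s \<Rightarrow> 'a::ab_group_add" and Y :: "'t \<Rightarrow> 'a"
  assumes X: "finite_rv P X" and Z: "finite_rv P Z" and Y: "finite_rv N Y"
  shows "ent_diff P X Z \<le> d_ent P X N Y + d_ent P Z N Y"
proof -
  let ?R = "P \<Otimes>\<^sub>M N"
  define x y z :: "'s \<times> 't \<Rightarrow> 'a"
    where "x = (\<lambda>w. X (fst w))" and "y = (\<lambda>w. Y (snd w))" and "z = (\<lambda>w. Z (fst w))"
  let ?H = "\<lambda>f. shannon_entropy ?R f"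
  note defs = x_def y_def z_def
  have P: "prob_space P" and N: "prob_space N" using X Y by (auto simp: finite_rv_def)
  have f: "finite_rv ?R x" "finite_rv ?R y" "finite_rv ?R z"
    using finite_rv_coords[OF X Y] finite_rv_coords[OF Z Y] by (auto simp: defs comp_def)
  note xy = finite_rv_diff[OF f(1,2)] and zy = finite_rv_diff[OF f(3,2)]
    and xz = finite_rv_diff[OF f(1,3)]
  note U = finite_rv_Pair[OF xy zy] and V = finite_rv_Pair[OF f(1,3)]
  have "shannon_entropy ?R (\<lambda>w. ((x w - y w, z w - y w), (x w, z w), x w - z w))
      = shannon_entropy ?R (\<lambda>w. ((x w, z w), y w))"
    \<comment> \<open>The value of \<open>y\<close> is recovered as \<open>a - d\<close>, where
      \<open>d\<close> stands for \<open>x - y\<close>.\<close>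
    by (rule shannon_entropy_determined[where f = "\<lambda>((a, c), b). ((a - b, c - b), (a, c), a - c)"
            and g = "\<lambda>((d, e), (a, c), _). ((a, c), a - d)"]) auto
  moreover have "\<dots> = ?H (\<lambda>w. (x w, z w)) + ?H y"
    using shannon_entropy_product[OF finite_rv_Pair[OF X Z] Y]
      shannon_entropy_fst[OF finite_rv_Pair[OF X Z] N] shannon_entropy_snd[OF Y P]
    by (simp add: defs)
  moreover have "?H (\<lambda>w. ((x w - y w, z w - y w), x w - z w)) = ?H (\<lambda>w. (x w - y w, z w - y w))"
    by (rule shannon_entropy_determined[where f = "\<lambda>(d, e). ((d, e), d - e)" and g = fst]) auto
  moreover have "?H (\<lambda>w. ((x w, z w), x w - z w)) = ?H (\<lambda>w. (x w, z w))"
    by (rule shannon_entropy_determined[where f = "\<lambda>(d, e). ((d, e), d - e)" and g = fst]) auto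
  ultimately have "?H y + ?H (\<lambda>w. x w - z w) \<le> ?H (\<lambda>w. (x w - y w, z w - y w))"
    using shannon_entropy_submodular[OF U V xz] by linarith
  also have "\<dots> \<le> ?H (\<lambda>w. x w - y w) + ?H (\<lambda>w. z w - y w)"
    by (rule shannon_entropy_subadditive[OF xy zy])
  \<comment> \<open>Each distance on the right contributes half of the entropy of \<open>y\<close>,
    together the full \<open>?H y\<close>; entropies of functions of the first coordinate pass back
    to \<open>P\<close>.\<close>
  finally show ?thesis
    using shannon_entropy_fst[OF finite_rv_diff[OF X Z] N]
      shannon_entropy_fst[OF X N] shannon_entropy_fst[OF Z N]
    by (simp add: d_ent_def ent_diff_def comp_def defs)
qed

text \<open>The bound for a single coupling involves only its marginals, which all couplings share,
  so it survives the supremum.\<close>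

lemma d_ent_max_triangle:
  assumes X: "finite_rv M1 X" and Y: "finite_rv M2 Y" and Z: "finite_rv M3 Z"
  shows "d_ent_max M1 X M3 Z \<le> d_ent M1 X M2 Y + d_ent M2 Y M3 Z"
  unfolding d_ent_max_def
proof (rule cSup_least[OF coupling_values_nonempty[OF X Z]])
  fix v assume "v \<in> coupling_values M1 X M3 Z"
  then obtain P :: "('b \<times> 'b) measure" and X' Z'
    where v: "v = ent_diff P X' Z'" and c: "coupling M1 X M3 Z P X' Z'"
    by (auto simp: coupling_values_def)
  have f: "finite_rv P X'" "finite_rv P Z'" and l: "same_law P X' M1 X" "same_law P Z' M3 Z"
    using c by (auto simp: coupling_def)
  have "v \<le> d_ent P X' M2 Y + d_ent P Z' M2 Y"
    unfolding v by (rule ent_diff_triangle[OF f Y])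
  also have "\<dots> = d_ent M1 X M2 Y + d_ent M3 Z M2 Y"
    using d_ent_cong[OF f(1) Y X Y l(1) same_law_refl]
      d_ent_cong[OF f(2) Y Z Y l(2) same_law_refl] by simp
  finally show "v \<le> d_ent M1 X M2 Y + d_ent M2 Y M3 Z"
    by (simp add: d_ent_commute[OF Z Y])
qed

text \<open>The independent pair is one of the couplings.\<close>

lemma d_ent_le_d_ent_max:
  assumes "finite_rv M X" "finite_rv N Y"
  shows "d_ent M X N Y \<le> d_ent_max M X N Y"
  unfolding d_ent_def d_ent_max_def
  by (intro cSup_upper coupling_value_in_values coupling_product bdd_above_coupling_values assms)

theorem lemma1p1:
  fixes M1 :: "'s measure" and M2 :: "'t measure" and M3 :: "'u measure"
    and X :: "'s \<Rightarrow> 'a::ab_group_add" and Y :: "'t \<Rightarrow> 'a" and Z :: "'u \<Rightarrow> 'a"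
  assumes "finite_rv M1 X" and "finite_rv M2 Y" and "finite_rv M3 Z"
  shows "d_ent_max M1 X M3 Z \<le> d_ent M1 X M2 Y + d_ent M2 Y M3 Z
    \<and> d_ent M1 X M2 Y \<le> d_ent_max M1 X M2 Y
    \<and> d_ent_max M1 X M2 Y \<le> 3 * d_ent M1 X M2 Y"
proof -
  note X = assms(1) and Y = assms(2)
  \<comment> \<open>This compares two independent copies of \<open>X\<close>, so it need not vanish;
    its bound accounts for two of the three summands in the factor 3.\<close>
  have "d_ent M1 X M1 X \<le> d_ent M1 X M2 Y + d_ent M2 Y M1 X"
    using d_ent_le_d_ent_max[OF X X] d_ent_max_triangle[OF X Y X] by linarith
  then have "d_ent_max M1 X M2 Y \<le> 3 * d_ent M1 X M2 Y"
    using d_ent_max_triangle[OF X X Y] d_ent_commute[OF X Y] by linarith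
  then show ?thesis
    using d_ent_max_triangle[OF assms] d_ent_le_d_ent_max[OF X Y] by blast
qed

end
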